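(* For $n\ge 0$ let $G(n)$ be the pseudofractal scale-free web after $n$ iterations, let $T_n(x,y)=T(G(n);x,y)$ be its Tutte polynomial, and let $T_{1,n}(x,y)$ be the partial sum of the Tutte polynomial over those spanning subgraphs in which the three hub nodes lie in the same connected component (see context). Then there are polynomials $P_n(x,y)$, $Q_n(x,y)$ ($n\ge 0$) such that for every $n\ge 0$ $$T_n(x,y)=T_{1,n}(x,y)+3(x-1)P_n(x,y)+(x-1)^2Q_n(x,y),$$ and $T_{1,n},P_n,Q_n$ satisfy, for every $n\ge 0$, the recurrence relations (all polynomials being evaluated at $(x,y)$) $$\begin{aligned}T_{1,n+1}=\;&(y-1)T_{1,n}^3+3(y-1)(x-1)T_{1,n}^2P_n+3(x-1)^2(y-1)T_{1,n}P_n^2+(x-1)^3(y-1)P_n^3\\&+3(x-1)T_{1,n}^2Q_n+6T_{1,n}^2P_n+12(x-1)T_{1,n}P_n^2+6(x-1)^2P_n^3\\&+3(x-1)^3P_n^2Q_n+6(x-1)^2T_{1,n}P_nQ_n,\end{aligned}$$ $$\begin{aligned}P_{n+1}=\;&4T_{1,n}P_n^2+4(x-1)T_{1,n}P_nQ_n+4(x-1)P_n^3+4(x-1)^2P_n^2Q_n\\&+(x-1)^2T_{1,n}Q_n^2+(x-1)^3P_nQ_n^2,\end{aligned}$$ $$Q_{n+1}=8P_n^3+12(x-1)P_n^2Q_n+6(x-1)^2P_nQ_n^2+(x-1)^3Q_n^3,$$ with initial conditions $T_{1,0}(x,y)=y+2$ and $P_0(x,y)=Q_0(x,y)=1$.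
   Context: Pseudofractal scale-free web: $G(0)$ is a triangle. For $n\ge1$, $G(n)$ is obtained from $G(n-1)$ by adding, for every edge of $G(n-1)$, one new vertex joined by new edges to both endpoints of that edge (the old edges are kept). The three vertices of the initial triangle $G(0)$ are called the hub nodes $A,B,C$ of $G(n)$. Equivalently, $G(n+1)$ consists of three copies $G_1,G_2,G_3$ of $G(n)$ in which hub $A$ of $G_1$ is identified with hub $B$ of $G_3$ (giving hub $A$ of $G(n+1)$), hub $A$ of $G_3$ with hub $B$ of $G_2$ (giving hub $B$), and hub $A$ of $G_2$ with hub $B$ of $G_1$ (giving hub $C$). A spanning subgraph $H$ of a graph $G=(V,E)$ is a subgraph with vertex set $V(H)=V$ (so it is determined by a subset of $E$). With $k(H)$ the number of connected components of $H$, put $r(H)=|V(H)|-k(H)$ and $n(H)=|E(H)|-r(H)$. The Tutte polynomial is $T(G;x,y)=\sum_{H}(x-1)^{r(G)-r(H)}(y-1)^{n(H)}$, the sum being over all spanning subgraphs $H$ of $G$. $D_{1,n}$ is the set of spanning subgraphs of $G(n)$ in which the three hub nodes belong to the same connected component, and $T_{1,n}(x,y)=\sum_{H\in D_{1,n}}(x-1)^{r(G(n))-r(H)}(y-1)^{n(H)}$. *)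

theory Defs
  imports "HOL-Library.Uprod" "HOL-Computational_Algebra.Polynomial"
begin

record 'a ugraph =
  verts :: "'a set"
  edges :: "'a uprod set"

definition spanning_subgraph :: "'a ugraph \<Rightarrow> 'a ugraph \<Rightarrow> bool" where
  "spanning_subgraph H G \<longleftrightarrow> verts H = verts G \<and> edges H \<subseteq> edges G"

definition connectivity :: "'a ugraph \<Rightarrow> ('a \<times> 'a) set" where
  "connectivity G = {(u, v). Upair u v \<in> edges G}\<^sup>* \<inter> verts G \<times> verts G"

definition components :: "'a ugraph \<Rightarrow> 'a set set" where
  "components G = verts G // connectivity G"

text \<open>
  The subtractions below are on natural numbers. On finite graphs whose edges have their endpoints
  among the vertices none of them truncates: there are at most as many components as vertices, at
  least \<open>|V| - |E|\<close> components, and removing edges cannot increase the rank.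
\<close>

definition rank :: "'a ugraph \<Rightarrow> nat" where
  "rank G = card (verts G) - card (components G)"

definition nullity :: "'a ugraph \<Rightarrow> nat" where
  "nullity G = card (edges G) - rank G"

text \<open>
  Bivariate integer polynomials are elements of \<open>\<int>[x][y]\<close>: the outer polynomial variable is \<open>y\<close>,
  and \<open>x\<close> is the variable of the coefficient ring, embedded as a constant.
\<close>

definition var_x :: "int poly poly" where
  "var_x = [:[:0, 1:]:]"

definition var_y :: "int poly poly" where
  "var_y = [:0, 1:]"

definition tutte_term :: "'a ugraph \<Rightarrow> 'a ugraph \<Rightarrow> int poly poly" where
  "tutte_term G H = (var_x - 1) ^ (rank G - rank H) * (var_y - 1) ^ nullity H"

definition tutte :: "'a ugraph \<Rightarrow> int poly poly" where
  "tutte G = (\<Sum>H | spanning_subgraph H G. tutte_term G H)"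

text \<open>
  \<open>New n e\<close> is the vertex added for the edge \<open>e\<close> in passing from generation \<open>n\<close> to \<open>n + 1\<close>.
  The index \<open>n\<close> is needed because \<open>e\<close> is kept and gives rise to another new vertex in every
  later generation.
\<close>

datatype vertex = HubA | HubB | HubC | New nat "vertex uprod"

primrec pseudofractal :: "nat \<Rightarrow> vertex ugraph" where
  "pseudofractal 0 =
     \<lparr>verts = {HubA, HubB, HubC},
      edges = {Upair HubA HubB, Upair HubB HubC, Upair HubC HubA}\<rparr>"
| "pseudofractal (Suc n) =
     \<lparr>verts = verts (pseudofractal n) \<union> New n ` edges (pseudofractal n),
      edges = edges (pseudofractal n) \<union>
        {Upair u (New n e) | u e. e \<in> edges (pseudofractal n) \<and> u \<in> set_uprod e}\<rparr>"

definition D1 :: "nat \<Rightarrow> vertex ugraph set" where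
  "D1 n = {H. spanning_subgraph H (pseudofractal n) \<and>
              (\<exists>K\<in>components H. {HubA, HubB, HubC} \<subseteq> K)}"

definition T1 :: "nat \<Rightarrow> int poly poly" where
  "T1 n = (\<Sum>H\<in>D1 n. tutte_term (pseudofractal n) H)"

end

theory Submission
  imports Defs
begin

text \<open>
  Give every edge a weight \<open>a\<close> if it is kept and \<open>b\<close> if it is deleted. Summing over the three edges
  at and opposite a newly added vertex turns the weighted Tutte sum of \<open>G(n+1)\<close> into that of
  \<open>G(n)\<close> with \<open>a\<close> replaced by \<open>(y - 1) a\<^sup>3 + 3 a\<^sup>2 b + (x - 1) a b\<^sup>2\<close> and \<open>b\<close> by
  \<open>2 a b\<^sup>2 + (x - 1) b\<^sup>3\<close>, and it does not change which old vertices are connected. Iterating from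
  \<open>a = b = 1\<close> reduces both \<open>T\<^sub>n\<close> and \<open>T\<^sub>1\<^sub>,\<^sub>n\<close> to sums over the triangle with weights \<open>a\<^sub>n\<close>, \<open>b\<^sub>n\<close>,
  whence \<open>T\<^sub>1\<^sub>,\<^sub>n = (y - 1) a\<^sub>n\<^sup>3 + 3 a\<^sub>n\<^sup>2 b\<^sub>n\<close>, \<open>P\<^sub>n = a\<^sub>n b\<^sub>n\<^sup>2\<close> and \<open>Q\<^sub>n = b\<^sub>n\<^sup>3\<close>. In these terms
  \<open>a\<^sub>n\<^sub>+\<^sub>1 = T\<^sub>1\<^sub>,\<^sub>n + (x - 1) P\<^sub>n\<close> and \<open>b\<^sub>n\<^sub>+\<^sub>1 = 2 P\<^sub>n + (x - 1) Q\<^sub>n\<close>, which are the recurrences.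
\<close>

section \<open>Connectivity and the number of components\<close>

definition adj :: "'a uprod set \<Rightarrow> ('a \<times> 'a) set" where
  "adj F = {(u, v). Upair u v \<in> F}"

text \<open>Vertices and edges are separate arguments so that either can change alone, as when an
  isolated vertex is added.\<close>

definition comp_of :: "'a set \<Rightarrow> 'a uprod set \<Rightarrow> 'a \<Rightarrow> 'a set" where
  "comp_of V F x = {z \<in> V. (x, z) \<in> (adj F)\<^sup>*}"

definition ncomp :: "'a set \<Rightarrow> 'a uprod set \<Rightarrow> nat" where
  "ncomp V F = card (comp_of V F ` V)"

definition edges_in :: "'a uprod set \<Rightarrow> 'a set \<Rightarrow> bool" where
  "edges_in F V \<longleftrightarrow> (\<forall>e\<in>F. set_uprod e \<subseteq> V)"

lemma sym_adj: "sym (adj F)"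
proof (rule symI)
  fix u v assume "(u, v) \<in> adj F"
  then show "(v, u) \<in> adj F"
    unfolding adj_def mem_Collect_eq case_prod_conv by (metis Upair_inject)
qed

lemma adj_rtrancl_sym: "(u, v) \<in> (adj F)\<^sup>* \<Longrightarrow> (v, u) \<in> (adj F)\<^sup>*"
  using sym_adj sym_rtrancl symD by metis

lemma adj_mono: "F \<subseteq> F' \<Longrightarrow> (adj F)\<^sup>* \<subseteq> (adj F')\<^sup>*"
  by (rule rtrancl_mono) (auto simp: adj_def)

lemma adj_insert: "adj (insert (Upair u v) F) = insert (u, v) (insert (v, u) (adj F))"
  by (auto simp: adj_def)

lemma adj_insert_loop: "(adj (insert (Upair u u) F))\<^sup>* = (adj F)\<^sup>*"
  by (rule rtrancl_subset) (auto simp: adj_insert)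

lemma components_eq: "components H = comp_of (verts H) (edges H) ` verts H"
  by (auto simp: components_def quotient_def connectivity_def comp_of_def adj_def image_iff)

lemma comp_of_eq_iff:
  assumes "x \<in> V" "z \<in> V"
  shows "comp_of V F x = comp_of V F z \<longleftrightarrow> (x, z) \<in> (adj F)\<^sup>*"
  using assms unfolding comp_of_def
  by (auto dest: adj_rtrancl_sym intro: rtrancl_trans)

lemma ncomp_le_card: "finite V \<Longrightarrow> ncomp V F \<le> card V"
  unfolding ncomp_def by (rule card_image_le)

lemma ncomp_pos: "finite V \<Longrightarrow> V \<noteq> {} \<Longrightarrow> ncomp V F \<ge> 1"
  unfolding ncomp_def by (simp add: Suc_le_eq card_gt_0_iff)

lemma ncomp_empty: "ncomp V {} = card V"
proof -
  have "inj_on (comp_of V {}) V"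
    by (auto simp: inj_on_def comp_of_eq_iff adj_def)
  then show ?thesis by (simp add: ncomp_def card_image)
qed

text \<open>A path through the new edge puts both \<open>x\<close> and \<open>z\<close> into the old
  classes of \<open>u\<close> and \<open>v\<close>. If neither lies in the class of
  \<open>u\<close>, both lie in that of \<open>v\<close> and were already connected.\<close>

lemma adj_insert_cases:
  assumes "(x, z) \<in> (adj (insert (Upair u v) F))\<^sup>*"
  shows "(x, z) \<in> (adj F)\<^sup>* \<or> (u, x) \<in> (adj F)\<^sup>* \<or> (u, z) \<in> (adj F)\<^sup>*"
proof -
  let ?R = "(adj F)\<^sup>*"
  have "(x, z) \<in> ?R \<or> ((u, x) \<in> ?R \<or> (v, x) \<in> ?R) \<and> ((u, z) \<in> ?R \<or> (v, z) \<in> ?R)"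
    using assms
  proof (induction rule: rtrancl_induct)
    case base
    then show ?case by simp
  next
    case (step z z')
    then show ?case
      by (auto simp: adj_insert intro: adj_rtrancl_sym rtrancl_into_rtrancl)
  qed
  then show ?thesis by (auto dest: adj_rtrancl_sym intro: rtrancl_trans)
qed

text \<open>Only the class of \<open>u\<close> can merge with another one, so sending an old
  component to the new component around it is injective away from the class of
  \<open>u\<close>.\<close>

lemma ncomp_insert_ge:
  assumes "finite V" "u \<in> V"
  shows "ncomp V F \<le> Suc (ncomp V (insert (Upair u v) F))"
proof -
  let ?F = "insert (Upair u v) F"
  let ?C = "comp_of V F ` V" and ?f = "\<lambda>K. {z \<in> V. \<exists>x\<in>K. (x, z) \<in> (adj ?F)\<^sup>*}"
  have f: "?f (comp_of V F x) = comp_of V ?F x" if "x \<in> V" for x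
  proof -
    have "(adj F)\<^sup>* \<subseteq> (adj ?F)\<^sup>*" by (rule adj_mono) auto
    then have "(\<exists>y\<in>V. (x, y) \<in> (adj F)\<^sup>* \<and> (y, z) \<in> (adj ?F)\<^sup>*) \<longleftrightarrow> (x, z) \<in> (adj ?F)\<^sup>*" for z
      using that by (meson rtrancl.rtrancl_refl rtrancl_trans subsetD)
    then show ?thesis by (auto simp: comp_of_def)
  qed
  have "inj_on ?f (?C - {comp_of V F u})"
  proof (rule inj_onI)
    fix K L
    assume K: "K \<in> ?C - {comp_of V F u}" and L: "L \<in> ?C - {comp_of V F u}" and eq: "?f K = ?f L"
    obtain x z where xz: "x \<in> V" "z \<in> V" "K = comp_of V F x" "L = comp_of V F z"
      using K L by auto
    have "comp_of V ?F x = comp_of V ?F z"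
      using eq unfolding xz(3,4) f[OF xz(1)] f[OF xz(2)] .
    then have "(x, z) \<in> (adj ?F)\<^sup>*"
      unfolding comp_of_eq_iff[OF xz(1,2)] .
    moreover have "(u, x) \<notin> (adj F)\<^sup>*" "(u, z) \<notin> (adj F)\<^sup>*"
      using K L xz comp_of_eq_iff[OF assms(2) xz(1), of F] comp_of_eq_iff[OF assms(2) xz(2), of F]
      by blast+
    ultimately have "(x, z) \<in> (adj F)\<^sup>*"
      using adj_insert_cases[of x z u v F] by blast
    then show "K = L" unfolding xz(3,4) comp_of_eq_iff[OF xz(1,2)] .
  qed
  moreover have "?f ` (?C - {comp_of V F u}) \<subseteq> comp_of V ?F ` V"
  proof (rule image_subsetI)
    show "?f K \<in> comp_of V ?F ` V" if K: "K \<in> ?C - {comp_of V F u}" for K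
    proof -
      obtain x where x: "x \<in> V" "K = comp_of V F x" using K by auto
      show ?thesis unfolding x(2) f[OF x(1)] using x(1) by (rule imageI)
    qed
  qed
  ultimately have "card (?C - {comp_of V F u}) \<le> ncomp V ?F"
    unfolding ncomp_def using assms(1) by (intro card_inj_on_le) auto
  moreover have "card (?C - {comp_of V F u}) = card ?C - 1"
    using assms by (intro card_Diff_singleton) auto
  ultimately show ?thesis unfolding ncomp_def by linarith
qed

text \<open>Each added edge lowers the number of components by at most one. The bound keeps the
  nullity exponent in \<open>weight\<close> from being truncated.\<close>

lemma card_le_edges_plus_ncomp:
  assumes "finite F" "finite V" "edges_in F V"
  shows "card V \<le> card F + ncomp V F"
  using assms(1,3)
proof (induction F)
  case empty
  then show ?case by (simp add: ncomp_empty)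
next
  case (insert e F)
  obtain u v where e: "e = Upair u v" by (cases e) auto
  then have "u \<in> V" using insert.prems by (simp add: edges_in_def)
  then have "ncomp V F \<le> Suc (ncomp V (insert e F))"
    using ncomp_insert_ge assms(2) e by metis
  moreover have "card V \<le> card F + ncomp V F"
    using insert by (auto simp: edges_in_def)
  ultimately show ?case using insert by simp
qed

text \<open>For the old vertices, a detour from \<open>u\<close> to \<open>v\<close> through the
  fresh vertex \<open>w\<close> has the same effect as a direct edge.\<close>

lemma adj_attach:
  assumes "edges_in F V" "w \<notin> V" "x \<in> V" "z \<in> V" "u \<in> V" "v \<in> V"
  shows "(x, z) \<in> (adj (insert (Upair u w) (insert (Upair v w) F)))\<^sup>* \<longleftrightarrow>
    (x, z) \<in> (adj (insert (Upair u v) F))\<^sup>*" (is "_ \<in> ?R'\<^sup>* \<longleftrightarrow> _ \<in> ?R\<^sup>*")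
proof
  \<comment> \<open>Retracting \<open>w\<close> onto \<open>u\<close> turns the edge
    \<open>u w\<close> into a trivial path and the edge \<open>v w\<close> into the direct edge, so
    paths through \<open>w\<close> project to paths among old vertices.\<close>
  let ?p = "\<lambda>t. if t = w then u else t"
  have edge: "(?p s, ?p t) \<in> ?R\<^sup>*" if "(s, t) \<in> ?R'" for s t
  proof -
    have "s \<noteq> w \<and> t \<noteq> w" if "(s, t) \<in> adj F"
      using that assms(1,2) by (fastforce simp: adj_def edges_in_def)
    with \<open>(s, t) \<in> ?R'\<close> assms show ?thesis by (auto simp: adj_insert)
  qed
  assume "(x, z) \<in> ?R'\<^sup>*"
  then have "(?p x, ?p z) \<in> ?R\<^sup>*"
  proof (induction rule: rtrancl_induct)
    case (step s t)
    show ?case using step.IH edge[OF step.hyps(2)] by (rule rtrancl_trans)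
  qed simp
  with assms show "(x, z) \<in> ?R\<^sup>*" by (auto split: if_splits)
next
  have "(u, v) \<in> ?R'\<^sup>*" "(v, u) \<in> ?R'\<^sup>*"
    by (rule rtrancl_trans[of _ w]; auto simp: adj_insert)+
  then have "?R \<subseteq> ?R'\<^sup>*" by (auto simp: adj_insert)
  then show "(x, z) \<in> ?R'\<^sup>*" if "(x, z) \<in> ?R\<^sup>*"
    using that rtrancl_subset_rtrancl by blast
qed

text \<open>The vertex \<open>w\<close> joins the component of \<open>u\<close> and changes nothing
  else; deleting \<open>w\<close> from a component inverts this map.\<close>

lemma ncomp_attach:
  assumes "edges_in F V" "w \<notin> V" "u \<in> V" "v \<in> V"
  shows "ncomp (insert w V) (insert (Upair u w) (insert (Upair v w) F)) =
    ncomp V (insert (Upair u v) F)"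
proof -
  let ?F' = "insert (Upair u w) (insert (Upair v w) F)" and ?F = "insert (Upair u v) F"
  let ?c' = "comp_of (insert w V) ?F'" and ?c = "comp_of V ?F"
  let ?f = "\<lambda>K. if u \<in> K then insert w K else K"
  have uw: "(u, w) \<in> (adj ?F')\<^sup>*" by (auto simp: adj_insert)
  then have xw: "(x, w) \<in> (adj ?F')\<^sup>* \<longleftrightarrow> (x, u) \<in> (adj ?F')\<^sup>*" for x
    by (auto dest: adj_rtrancl_sym intro: rtrancl_trans)
  have f: "?c' x = ?f (?c x)" if "x \<in> V" for x
    using that assms adj_attach[OF assms(1,2) that _ assms(3,4)] xw[of x]
    by (auto simp: comp_of_def)
  have "?c' w = ?c' u" using uw assms by (subst comp_of_eq_iff) (auto intro: adj_rtrancl_sym)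
  then have "?c' ` insert w V = ?c' ` V" using assms by auto
  also have "\<dots> = ?f ` ?c ` V" using f by (auto simp: image_image)
  finally have img: "?c' ` insert w V = ?f ` ?c ` V" .
  have "inj_on ?f (?c ` V)"
  proof (rule inj_on_inverseI[where g = "\<lambda>K. K - {w}"])
    show "?f K - {w} = K" if "K \<in> ?c ` V" for K
      using that assms(2) by (auto simp: comp_of_def)
  qed
  then have "card (?f ` ?c ` V) = card (?c ` V)" by (rule card_image)
  then show ?thesis unfolding ncomp_def img .
qed

lemma ncomp_isolated:
  assumes "edges_in F V" "w \<notin> V" "finite V"
  shows "ncomp (insert w V) F = Suc (ncomp V F)"
proof -
  have w: "(x, w) \<in> (adj F)\<^sup>* \<longleftrightarrow> x = w" for x
  proof
    assume "(x, w) \<in> (adj F)\<^sup>*"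
    then show "x = w"
      using assms(1,2) by (cases rule: rtranclE) (fastforce simp: adj_def edges_in_def)+
  qed auto
  have "comp_of (insert w V) F x = comp_of V F x" if "x \<in> V" for x
    using that assms w by (auto simp: comp_of_def)
  moreover have "comp_of (insert w V) F w = {w}"
    using assms w adj_rtrancl_sym by (fastforce simp: comp_of_def)
  ultimately have "comp_of (insert w V) F ` insert w V = insert {w} (comp_of V F ` V)"
    by auto
  moreover have "{w} \<notin> comp_of V F ` V" using assms(2) by (auto simp: comp_of_def)
  ultimately show ?thesis using assms(3) by (simp add: ncomp_def)
qed

text \<open>This is \<open>ncomp_attach\<close> with \<open>u = v\<close>: the two new edges
  coincide, and the direct edge becomes a loop, which connects nothing.\<close>

lemma ncomp_pendant:
  assumes "edges_in F V" "w \<notin> V" "u \<in> V"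
  shows "ncomp (insert w V) (insert (Upair u w) F) = ncomp V F"
  using ncomp_attach[OF assms assms(3)]
  by (simp add: ncomp_def comp_of_def adj_insert_loop)

section \<open>Weights of spanning subgraphs and the effect of one new vertex\<close>

text \<open>The condition is vacuous for \<open>S = {}\<close>, so one argument serves both the full
  Tutte sum and the sum with the hubs connected.\<close>

definition joined :: "'a set \<Rightarrow> 'a uprod set \<Rightarrow> bool" where
  "joined S F \<longleftrightarrow> S \<times> S \<subseteq> (adj F)\<^sup>*"

text \<open>For a connected ambient graph this is the Tutte term with \<open>p = x - 1\<close> and
  \<open>q = y - 1\<close>: the rank defect is the number of components minus one, and the other
  exponent is the nullity.\<close>

definition weight :: "'b::comm_ring_1 \<Rightarrow> 'b \<Rightarrow> 'a set \<Rightarrow> 'a set \<Rightarrow> 'a uprod set \<Rightarrow> 'b" where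
  "weight p q S V F =
    (if joined S F then p ^ (ncomp V F - 1) * q ^ (card F + ncomp V F - card V) else 0)"

lemma joined_attach:
  assumes "edges_in F V" "w \<notin> V" "u \<in> V" "v \<in> V" "S \<subseteq> V"
  shows "joined S (insert (Upair u w) (insert (Upair v w) F)) \<longleftrightarrow>
    joined S (insert (Upair u v) F)"
  using adj_attach[OF assms(1,2) _ _ assms(3,4)] assms(5) unfolding joined_def by blast

lemma joined_pendant:
  assumes "edges_in F V" "w \<notin> V" "u \<in> V" "S \<subseteq> V"
  shows "joined S (insert (Upair u w) F) \<longleftrightarrow> joined S F"
  using joined_attach[OF assms(1-3) assms(3,4)] by (simp add: joined_def adj_insert_loop)

lemma not_in_edges_in: "edges_in F V \<Longrightarrow> w \<notin> V \<Longrightarrow> Upair u w \<notin> F"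
  by (fastforce simp: edges_in_def)

lemma card_attach:
  assumes "edges_in F V" "w \<notin> V" "u \<in> V" "v \<in> V" "u \<noteq> v" "finite F"
  shows "card (insert (Upair u w) (insert (Upair v w) F)) = Suc (Suc (card F))"
proof -
  have "u \<noteq> w" "v \<noteq> w" using assms by auto
  then show ?thesis using assms not_in_edges_in[OF assms(1,2)] by simp
qed

text \<open>One more vertex and one more component leave the nullity unchanged and raise the rank
  defect by one.\<close>

lemma weight_isolated:
  assumes "edges_in F V" "w \<notin> V" "finite V" "V \<noteq> {}"
  shows "weight p q S (insert w V) F = p * weight p q S V F"
proof -
  \<comment> \<open>Since \<open>V\<close> is nonempty, there is at least one component and the
    subtraction is exact.\<close>
  have "ncomp V F = Suc (ncomp V F - 1)" using ncomp_pos[OF assms(3,4), of F] by simp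
  then have "p ^ ncomp V F = p * p ^ (ncomp V F - 1)" by (metis power_Suc)
  then show ?thesis using assms by (simp add: weight_def ncomp_isolated)
qed

text \<open>Vertex and edge counts both grow by one and the components correspond, so both exponents
  are unchanged.\<close>

lemma weight_pendant:
  assumes "edges_in F V" "w \<notin> V" "finite V" "u \<in> V" "finite F" "S \<subseteq> V"
  shows "weight p q S (insert w V) (insert (Upair u w) F) = weight p q S V F"
  using assms not_in_edges_in[OF assms(1,2)]
  by (simp add: weight_def ncomp_pendant joined_pendant)

text \<open>Series reduction: compared with the single edge, the path has one more vertex and one
  more edge, and it connects the same old vertices.\<close>

lemma weight_path:
  assumes "edges_in F V" "w \<notin> V" "finite V" "u \<in> V" "v \<in> V" "u \<noteq> v" "finite F" "S \<subseteq> V"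
    "Upair u v \<notin> F"
  shows "weight p q S (insert w V) (insert (Upair u w) (insert (Upair v w) F)) =
    weight p q S V (insert (Upair u v) F)"
  using assms
  by (simp add: weight_def ncomp_attach joined_attach card_attach)

text \<open>As \<open>u\<close> and \<open>v\<close> are already adjacent, the path closes a cycle:
  two edges and one vertex more, with as many components, raise the nullity by one.\<close>

lemma weight_triangle:
  assumes "edges_in F V" "w \<notin> V" "finite V" "u \<in> V" "v \<in> V" "u \<noteq> v" "finite F" "S \<subseteq> V"
    "Upair u v \<in> F"
  shows "weight p q S (insert w V) (insert (Upair u w) (insert (Upair v w) F)) =
    q * weight p q S V F"
proof -
  have "card V \<le> card F + ncomp V F" using card_le_edges_plus_ncomp assms by metis
  then have "Suc (card F + ncomp V F) - card V = Suc (card F + ncomp V F - card V)"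
    by simp
  then show ?thesis
    using assms
    by (simp add: weight_def ncomp_attach joined_attach card_attach insert_absorb[OF assms(9)])
qed

section \<open>Weighted Tutte sums and elimination of vertices\<close>

text \<open>Weights may differ from edge to edge because eliminating the new vertices one by one
  passes through stages where only some edges are reweighted.\<close>

definition weighted_sum ::
  "'b::comm_ring_1 \<Rightarrow> 'b \<Rightarrow> 'a set \<Rightarrow> 'a set \<Rightarrow> 'a uprod set \<Rightarrow>
    ('a uprod \<Rightarrow> 'b) \<Rightarrow> ('a uprod \<Rightarrow> 'b) \<Rightarrow> 'b" where
  "weighted_sum p q S V E \<alpha> \<beta> =
    (\<Sum>F\<in>Pow E. weight p q S V F * (\<Prod>e\<in>E. if e \<in> F then \<alpha> e else \<beta> e))"

lemma sum_Pow_insert: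
  assumes "finite A" "a \<notin> A"
  shows "sum f (Pow (insert a A)) = (\<Sum>F\<in>Pow A. f F + f (insert a F))"
proof -
  have "inj_on (insert a) (Pow A)" using assms(2) by (auto simp: inj_on_def)
  moreover have "Pow A \<inter> insert a ` Pow A = {}" using assms(2) by auto
  ultimately show ?thesis
    using assms(1) by (simp add: Pow_insert sum.union_disjoint sum.reindex sum.distrib)
qed

lemma prod_insert_other:
  assumes "a \<notin> A"
  shows "(\<Prod>e\<in>A. if e = a \<or> P e then f e else g e) = (\<Prod>e\<in>A. if P e then f e else g e)"
  using assms by (intro prod.cong) auto

text \<open>The sum is split by whether \<open>e\<close> is kept. As \<open>W\<close> is arbitrary,
  the bracketed factor can play its role in turn, so the split can be repeated.\<close>

lemma weighted_Pow_insert: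
  fixes W :: "'a set \<Rightarrow> 'b::comm_ring_1"
  assumes "finite E" "e \<notin> E"
  shows "(\<Sum>F\<in>Pow (insert e E). W F * (\<Prod>e\<in>insert e E. if e \<in> F then \<alpha> e else \<beta> e)) =
    (\<Sum>F\<in>Pow E. (\<beta> e * W F + \<alpha> e * W (insert e F)) *
      (\<Prod>e\<in>E. if e \<in> F then \<alpha> e else \<beta> e))"
proof -
  have *: "e \<notin> F" if "F \<subseteq> E" for F using that assms(2) by auto
  show ?thesis
    unfolding sum_Pow_insert[OF assms]
    using assms by (intro sum.cong) (auto simp: * prod_insert_other algebra_simps)
qed

lemma weighted_sum_cong:
  assumes "\<And>e. e \<in> E \<Longrightarrow> \<alpha> e = \<alpha>' e" "\<And>e. e \<in> E \<Longrightarrow> \<beta> e = \<beta>' e"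
  shows "weighted_sum p q S V E \<alpha> \<beta> = weighted_sum p q S V E \<alpha>' \<beta>'"
  unfolding weighted_sum_def using assms by (auto intro!: sum.cong prod.cong arg_cong2[of _ _ _ _ times])

text \<open>Fix the state of all other edges and sum over the eight states of the triangle on
  \<open>u\<close>, \<open>v\<close>, \<open>w\<close>. Five of them connect \<open>u\<close> and
  \<open>v\<close> inside the triangle and make up the weight of a kept edge; the other three make
  up the weight of a deleted edge.\<close>

lemma weighted_sum_eliminate_vertex:
  fixes p q :: "'b::comm_ring_1"
  assumes fin: "finite V" "finite E" and E: "edges_in E V" "Upair u v \<in> E"
    and w: "w \<notin> V" and "u \<noteq> v" and S: "S \<subseteq> V"
    and \<alpha>: "\<alpha> (Upair u v) = a" "\<alpha> (Upair u w) = a" "\<alpha> (Upair v w) = a"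
    and \<beta>: "\<beta> (Upair u v) = b" "\<beta> (Upair u w) = b" "\<beta> (Upair v w) = b"
  shows "weighted_sum p q S (insert w V) (insert (Upair u w) (insert (Upair v w) E)) \<alpha> \<beta> =
    weighted_sum p q S V E (\<alpha>(Upair u v := q * a ^ 3 + 3 * a\<^sup>2 * b + p * a * b\<^sup>2))
      (\<beta>(Upair u v := 2 * a * b\<^sup>2 + p * b ^ 3))"
proof -
  let ?e = "Upair u v" and ?f = "Upair u w" and ?g = "Upair v w"
  let ?a = "q * a ^ 3 + 3 * a\<^sup>2 * b + p * a * b\<^sup>2" and ?b = "2 * a * b\<^sup>2 + p * b ^ 3"
  let ?\<alpha> = "\<alpha>(?e := ?a)" and ?\<beta> = "\<beta>(?e := ?b)"
  let ?W' = "weight p q S (insert w V)" and ?W = "weight p q S V"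
  define D where "D = E - {?e}"
  have ED: "E = insert ?e D" and eD: "?e \<notin> D" and finD: "finite D" and D: "edges_in D V"
    using E fin by (auto simp: D_def edges_in_def)
  have uv: "u \<in> V" "v \<in> V" using E by (auto simp: edges_in_def)
  have fg: "?f \<notin> D" "?g \<notin> D" "?f \<noteq> ?g" "?f \<noteq> ?e" "?g \<noteq> ?e"
    using not_in_edges_in[OF D w] \<open>u \<noteq> v\<close> w uv by auto
  \<comment> \<open>The nesting is the one produced by splitting on \<open>?f\<close>, then
    \<open>?g\<close>, then \<open>?e\<close> with \<open>weighted_Pow_insert\<close>.\<close>
  have local: "b * (b * (b * ?W' F + a * ?W' (insert ?f F))
        + a * (b * ?W' (insert ?g F) + a * ?W' (insert ?f (insert ?g F))))
      + a * (b * (b * ?W' (insert ?e F) + a * ?W' (insert ?f (insert ?e F)))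
        + a * (b * ?W' (insert ?g (insert ?e F)) + a * ?W' (insert ?f (insert ?g (insert ?e F))))) =
      ?b * ?W F + ?a * ?W (insert ?e F)" (is "?L = _")
    if "F \<subseteq> D" for F
  proof -
    have F: "edges_in F V" "edges_in (insert ?e F) V" "finite F" "finite (insert ?e F)" "?e \<notin> F"
      and V: "V \<noteq> {}"
      using that D uv finD finite_subset eD by (auto simp: edges_in_def)
    have "?L = b * (b * (b * (p * ?W F) + a * ?W F) + a * (b * ?W F + a * ?W (insert ?e F)))
      + a * (b * (b * (p * ?W (insert ?e F)) + a * ?W (insert ?e F))
        + a * (b * ?W (insert ?e F) + a * (q * ?W (insert ?e F))))"
      unfolding weight_isolated[OF F(1) w fin(1) V] weight_isolated[OF F(2) w fin(1) V]
        weight_path[OF F(1) w fin(1) uv \<open>u \<noteq> v\<close> F(3) S F(5)]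
        weight_triangle[OF F(2) w fin(1) uv \<open>u \<noteq> v\<close> F(4) S insertI1]
        weight_pendant[OF F(1) w fin(1) uv(1) F(3) S] weight_pendant[OF F(1) w fin(1) uv(2) F(3) S]
        weight_pendant[OF F(2) w fin(1) uv(1) F(4) S] weight_pendant[OF F(2) w fin(1) uv(2) F(4) S]
      ..
    also have "\<dots> = ?b * ?W F + ?a * ?W (insert ?e F)"
      by (simp add: algebra_simps power2_eq_square power3_eq_cube)
    finally show ?thesis .
  qed
  have E': "insert ?f (insert ?g E) = insert ?f (insert ?g (insert ?e D))" using ED by simp
  have prod: "(\<Prod>e\<in>D. if e \<in> F then \<alpha> e else \<beta> e) = (\<Prod>e\<in>D. if e \<in> F then ?\<alpha> e else ?\<beta> e)" for F
    using eD by (intro prod.cong) auto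
  have "weighted_sum p q S (insert w V) (insert ?f (insert ?g E)) \<alpha> \<beta> =
    (\<Sum>F\<in>Pow D. (?b * ?W F + ?a * ?W (insert ?e F)) * (\<Prod>e\<in>D. if e \<in> F then \<alpha> e else \<beta> e))"
  proof -
    have "finite (insert ?g (insert ?e D))" "?f \<notin> insert ?g (insert ?e D)"
      "finite (insert ?e D)" "?g \<notin> insert ?e D"
      using finD eD fg by auto
    then show ?thesis
      unfolding weighted_sum_def E'
      by (simp only: weighted_Pow_insert finD eD \<alpha> \<beta> not_False_eq_True)
        (intro sum.cong refl arg_cong2[of _ _ _ _ times] local, simp)
  qed
  also have "\<dots> = weighted_sum p q S V E ?\<alpha> ?\<beta>"
    unfolding weighted_sum_def ED weighted_Pow_insert[OF finD eD] prod by simp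
  finally show ?thesis .
qed

definition loopless :: "'a uprod set \<Rightarrow> bool" where
  "loopless E \<longleftrightarrow> (\<forall>u. Upair u u \<notin> E)"

abbreviation new_edges :: "('a uprod \<Rightarrow> 'a) \<Rightarrow> 'a uprod set \<Rightarrow> 'a uprod set" where
  "new_edges N F \<equiv> {Upair u (N e) | u e. e \<in> F \<and> u \<in> set_uprod e}"

lemma new_edges_insert:
  "new_edges N (insert (Upair u v) F) =
    insert (Upair u (N (Upair u v))) (insert (Upair v (N (Upair u v))) (new_edges N F))"
proof -
  have "new_edges N (insert e F) = (\<lambda>w. Upair w (N e)) ` set_uprod e \<union> new_edges N F" for e
    by blast
  then show ?thesis by simp
qed

lemma finite_new_edges:
  assumes "finite F"
  shows "finite (new_edges N F)"
  using assms
proof (induction F)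
  case (insert e F)
  then show ?case by (cases e) (simp only: new_edges_insert finite_insert)
qed simp

text \<open>Induction on the set \<open>F\<close> of edges whose new vertices are present. The
  vertex of the inserted edge goes first, which changes the weight of that edge; hence
  \<open>\<alpha>\<close> and \<open>\<beta>\<close> are arbitrary in the induction.\<close>

lemma weighted_sum_eliminate_vertices:
  fixes p q a b :: "'b::comm_ring_1"
  assumes fin: "finite V" "finite E" and E: "edges_in E V" "loopless E"
    and N: "inj_on N E" "\<And>e. e \<in> E \<Longrightarrow> N e \<notin> V" and S: "S \<subseteq> V"
    and F: "finite F" "F \<subseteq> E"
    and ab: "\<And>e. e \<in> F \<union> new_edges N F \<Longrightarrow> \<alpha> e = a \<and> \<beta> e = b"
  shows "weighted_sum p q S (V \<union> N ` F) (E \<union> new_edges N F) \<alpha> \<beta> =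
    weighted_sum p q S V E (\<lambda>e. if e \<in> F then q * a ^ 3 + 3 * a\<^sup>2 * b + p * a * b\<^sup>2 else \<alpha> e)
      (\<lambda>e. if e \<in> F then 2 * a * b\<^sup>2 + p * b ^ 3 else \<beta> e)"
  using F ab
proof (induction F arbitrary: \<alpha> \<beta>)
  case empty
  then show ?case by simp
next
  case (insert e F)
  obtain u v where e: "e = Upair u v" by (cases e) auto
  let ?w = "N e" and ?V = "V \<union> N ` F" and ?E = "E \<union> new_edges N F"
  let ?\<alpha> = "\<alpha>(e := q * a ^ 3 + 3 * a\<^sup>2 * b + p * a * b\<^sup>2)"
    and ?\<beta> = "\<beta>(e := 2 * a * b\<^sup>2 + p * b ^ 3)"
  have uv: "u \<in> V" "v \<in> V" "u \<noteq> v" "e \<in> E"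
    using insert.prems(1) E e by (auto simp: edges_in_def loopless_def)
  have w: "?w \<notin> ?V"
    using insert.prems(1) insert.hyps(2) N by (auto simp: inj_on_def)
  have "edges_in ?E ?V"
    using E(1) insert.prems(1) by (fastforce simp: edges_in_def)
  moreover have "new_edges N (insert e F) = insert (Upair u ?w) (insert (Upair v ?w) (new_edges N F))"
    unfolding e by (rule new_edges_insert)
  moreover from this have "\<alpha> (Upair u v) = a" "\<alpha> (Upair u ?w) = a" "\<alpha> (Upair v ?w) = a"
    "\<beta> (Upair u v) = b" "\<beta> (Upair u ?w) = b" "\<beta> (Upair v ?w) = b"
    using insert.prems(2) e by auto
  ultimately have "weighted_sum p q S (V \<union> N ` insert e F) (E \<union> new_edges N (insert e F)) \<alpha> \<beta> =
      weighted_sum p q S ?V ?E ?\<alpha> ?\<beta>"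
    using weighted_sum_eliminate_vertex[of ?V ?E u v ?w S \<alpha> a \<beta> b p q] uv w fin insert.hyps(1) S
    by (simp add: e finite_new_edges le_supI1 del: Upair_inject)
  also have "\<dots> = weighted_sum p q S V E
      (\<lambda>e. if e \<in> F then q * a ^ 3 + 3 * a\<^sup>2 * b + p * a * b\<^sup>2 else ?\<alpha> e)
      (\<lambda>e. if e \<in> F then 2 * a * b\<^sup>2 + p * b ^ 3 else ?\<beta> e)"
  proof (rule insert.IH)
    fix f assume f: "f \<in> F \<union> new_edges N F"
    \<comment> \<open>Both ends of \<open>e\<close> lie in \<open>V\<close>, while every new edge
      has an end outside. Reweighting \<open>e\<close> therefore spares the edges still to be
      processed.\<close>
    have "e \<notin> new_edges N F"
      using uv insert.prems(1) N(2) e by auto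
    then have "f \<noteq> e" using f insert.hyps(2) by auto
    then show "?\<alpha> f = a \<and> ?\<beta> f = b" using insert.prems(2)[of f] f by auto
  qed (use insert.prems in auto)
  also have "\<dots> = weighted_sum p q S V E
      (\<lambda>f. if f \<in> insert e F then q * a ^ 3 + 3 * a\<^sup>2 * b + p * a * b\<^sup>2 else \<alpha> f)
      (\<lambda>f. if f \<in> insert e F then 2 * a * b\<^sup>2 + p * b ^ 3 else \<beta> f)"
    by (rule weighted_sum_cong) auto
  finally show ?case .
qed

section \<open>Structure of the web\<close>

abbreviation web_verts :: "nat \<Rightarrow> vertex set" where
  "web_verts n \<equiv> verts (pseudofractal n)"

abbreviation web_edges :: "nat \<Rightarrow> vertex uprod set" where
  "web_edges n \<equiv> edges (pseudofractal n)"

lemma web_edges_in: "edges_in (web_edges n) (web_verts n)"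
proof (induction n)
  case (Suc n)
  then show ?case by (fastforce simp: edges_in_def)
qed (auto simp: edges_in_def)

lemma finite_web: "finite (web_verts n) \<and> finite (web_edges n)"
  by (induction n) (simp_all add: finite_new_edges)

text \<open>This is what makes the vertices \<open>New n e\<close> fresh when generation
  \<open>n + 1\<close> is built.\<close>

lemma New_in_web: "New m e \<in> web_verts n \<Longrightarrow> m < n"
  by (induction n) (auto simp: less_Suc_eq)

lemma web_loopless: "loopless (web_edges n)"
proof (induction n)
  case (Suc n)
  have "u \<noteq> New n e" if "e \<in> web_edges n" "u \<in> set_uprod e" for u e
    using that web_edges_in[of n] New_in_web[of n e n] by (auto simp: edges_in_def)
  with Suc show ?case by (fastforce simp: loopless_def)
qed (auto simp: loopless_def)

lemma hubs_in_web: "{HubA, HubB, HubC} \<subseteq> web_verts n"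
  by (induction n) auto

lemma web_connected: "x \<in> web_verts n \<Longrightarrow> (HubA, x) \<in> (adj (web_edges n))\<^sup>*"
proof (induction n arbitrary: x)
  case 0
  then have "x = HubA \<or> (HubA, x) \<in> adj (web_edges 0)" by (auto simp: adj_def)
  then show ?case by blast
next
  case (Suc n)
  have old: "(HubA, z) \<in> (adj (web_edges (Suc n)))\<^sup>*" if "z \<in> web_verts n" for z
    using Suc.IH[OF that] adj_mono[of "web_edges n" "web_edges (Suc n)"] by auto
  show ?case
  proof (cases "x \<in> web_verts n")
    case False
    then obtain e where e: "e \<in> web_edges n" "x = New n e" using Suc.prems by auto
    obtain u v where uv: "e = Upair u v" by (cases e) auto
    have "u \<in> web_verts n" using e uv web_edges_in[of n] by (auto simp: edges_in_def)
    moreover have "(u, x) \<in> adj (web_edges (Suc n))"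
      using e uv by (fastforce simp: adj_def)
    ultimately show ?thesis using old rtrancl_into_rtrancl by metis
  qed (rule old)
qed

lemma ncomp_joined:
  assumes "joined V F" "V \<noteq> {}"
  shows "ncomp V F = 1"
proof -
  have "comp_of V F x = V" if "x \<in> V" for x
    using that assms(1) by (auto simp: comp_of_def joined_def)
  then have "comp_of V F ` V = {V}" using assms(2) by auto
  then show ?thesis by (simp add: ncomp_def)
qed

lemma ncomp_web: "ncomp (web_verts n) (web_edges n) = 1"
proof (rule ncomp_joined)
  have "(x, z) \<in> (adj (web_edges n))\<^sup>*" if "x \<in> web_verts n" "z \<in> web_verts n" for x z
    using adj_rtrancl_sym[OF web_connected[OF that(1)]] web_connected[OF that(2)]
    by (rule rtrancl_trans)
  then show "joined (web_verts n) (web_edges n)" unfolding joined_def by blast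
qed (use hubs_in_web[of n] in auto)

lemma rank_eq: "rank H = card (verts H) - ncomp (verts H) (edges H)"
  by (simp add: rank_def components_eq ncomp_def)

text \<open>The web is connected, so its rank is the number of vertices minus one. As there are at
  most as many components as vertices, the natural-number differences rearrange exactly.\<close>

lemma tutte_term_web:
  assumes "verts H = web_verts n"
  shows "tutte_term (pseudofractal n) H =
    (var_x - 1) ^ (ncomp (web_verts n) (edges H) - 1) *
    (var_y - 1) ^ (card (edges H) + ncomp (web_verts n) (edges H) - card (web_verts n))"
proof -
  have "ncomp (web_verts n) (edges H) \<le> card (web_verts n)"
    using finite_web ncomp_le_card by metis
  then show ?thesis
    using assms by (simp add: tutte_term_def nullity_def rank_eq ncomp_web)
qed

section \<open>Tutte sums of the web as weighted sums\<close>

abbreviation web_sum :: "vertex set \<Rightarrow> nat \<Rightarrow> int poly poly \<Rightarrow> int poly poly \<Rightarrow> int poly poly" where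
  "web_sum S n a b \<equiv>
    weighted_sum (var_x - 1) (var_y - 1) S (web_verts n) (web_edges n) (\<lambda>_. a) (\<lambda>_. b)"

text \<open>Unit edge weights make every product 1, \<open>weight\<close> vanishes where
  \<open>S\<close> is not joined, and a spanning subgraph is determined by its edge set.\<close>

lemma sum_joined_web:
  "(\<Sum>H | spanning_subgraph H (pseudofractal n) \<and> joined S (edges H). tutte_term (pseudofractal n) H) =
    web_sum S n 1 1"
proof -
  let ?A = "{H. spanning_subgraph H (pseudofractal n) \<and> joined S (edges H)}"
    and ?f = "\<lambda>F. \<lparr>verts = web_verts n, edges = F\<rparr>"
  have "web_sum S n 1 1 = (\<Sum>F\<in>Pow (web_edges n).
      weight (var_x - 1) (var_y - 1) S (web_verts n) F)"
    by (simp add: weighted_sum_def)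
  also have "\<dots> = (\<Sum>F | F \<subseteq> web_edges n \<and> joined S F. tutte_term (pseudofractal n) (?f F))"
    using finite_web by (intro sum.mono_neutral_cong_right) (auto simp: weight_def tutte_term_web)
  also have "\<dots> = (\<Sum>H\<in>?A. tutte_term (pseudofractal n) H)"
    by (rule sum.reindex_bij_witness[where i = edges and j = ?f])
      (auto simp: spanning_subgraph_def)
  finally show ?thesis by simp
qed

lemma tutte_web: "tutte (pseudofractal n) = web_sum {} n 1 1"
  using sum_joined_web[of n "{}"] by (simp add: tutte_def joined_def)

lemma joined_iff_component:
  assumes "S \<subseteq> verts H" "S \<noteq> {}"
  shows "joined S (edges H) \<longleftrightarrow> (\<exists>K\<in>components H. S \<subseteq> K)"
proof
  assume j: "joined S (edges H)"
  obtain x where "x \<in> S" using assms(2) by blast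
  then have "S \<subseteq> comp_of (verts H) (edges H) x" "x \<in> verts H"
    using j assms(1) unfolding joined_def comp_of_def by blast+
  then show "\<exists>K\<in>components H. S \<subseteq> K" unfolding components_eq by blast
next
  assume "\<exists>K\<in>components H. S \<subseteq> K"
  then obtain x where x: "S \<subseteq> comp_of (verts H) (edges H) x" unfolding components_eq by blast
  have "(s, t) \<in> (adj (edges H))\<^sup>*" if "s \<in> S" "t \<in> S" for s t
  proof (rule rtrancl_trans)
    show "(s, x) \<in> (adj (edges H))\<^sup>*" "(x, t) \<in> (adj (edges H))\<^sup>*"
      using x that adj_rtrancl_sym[of x s "edges H"] by (auto simp: comp_of_def)
  qed
  then show "joined S (edges H)" unfolding joined_def by blast
qed

lemma T1_web: "T1 n = web_sum {HubA, HubB, HubC} n 1 1"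
proof -
  have "D1 n = {H. spanning_subgraph H (pseudofractal n) \<and> joined {HubA, HubB, HubC} (edges H)}"
    unfolding D1_def using hubs_in_web joined_iff_component[of "{HubA, HubB, HubC}"]
    by (auto simp: spanning_subgraph_def)
  then show ?thesis by (simp add: T1_def sum_joined_web)
qed

section \<open>Iteration down to the triangle\<close>

text \<open>The effective weights of an edge once its new vertex is eliminated, as a map on pairs so
  that it can be iterated.\<close>

definition edge_step :: "int poly poly \<times> int poly poly \<Rightarrow> int poly poly \<times> int poly poly" where
  "edge_step = (\<lambda>(a, b). ((var_y - 1) * a ^ 3 + 3 * a\<^sup>2 * b + (var_x - 1) * a * b\<^sup>2,
    2 * a * b\<^sup>2 + (var_x - 1) * b ^ 3))"

lemma web_sum_Suc:
  assumes "S \<subseteq> web_verts n"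
  shows "web_sum S (Suc n) a b = web_sum S n (fst (edge_step (a, b))) (snd (edge_step (a, b)))"
proof -
  have "New n e \<notin> web_verts n" for e by (meson New_in_web less_irrefl)
  then have "web_sum S (Suc n) a b = weighted_sum (var_x - 1) (var_y - 1) S (web_verts n) (web_edges n)
      (\<lambda>e. if e \<in> web_edges n then fst (edge_step (a, b)) else a)
      (\<lambda>e. if e \<in> web_edges n then snd (edge_step (a, b)) else b)"
    using weighted_sum_eliminate_vertices[of "web_verts n" "web_edges n" "New n" S "web_edges n"
        "\<lambda>_. a" a "\<lambda>_. b" b] finite_web web_edges_in web_loopless assms
    unfolding edge_step_def case_prod_conv fst_conv snd_conv by (simp add: inj_on_def)
  also have "\<dots> = web_sum S n (fst (edge_step (a, b))) (snd (edge_step (a, b)))"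
    by (rule weighted_sum_cong) auto
  finally show ?thesis .
qed

text \<open>The newest generation is eliminated first, so the weights change along the induction.
  Hubs are never eliminated, which is why \<open>S\<close> must consist of hubs.\<close>

lemma web_sum_iterate:
  assumes "S \<subseteq> {HubA, HubB, HubC}"
  shows "web_sum S n a b = web_sum S 0 (fst ((edge_step ^^ n) (a, b))) (snd ((edge_step ^^ n) (a, b)))"
proof (induction n arbitrary: a b)
  case (Suc n)
  have S: "S \<subseteq> web_verts n" using assms hubs_in_web by blast
  show ?case
    unfolding web_sum_Suc[OF S] Suc.IH by (simp only: funpow_Suc_right o_apply prod.collapse)
qed simp

section \<open>The triangle with arbitrary weights\<close>

text \<open>The triangle is a single edge with one vertex added for it.\<close>

lemma tutte_sum_triangle:
  "web_sum {} 0 a b = (var_y - 1) * a ^ 3 + 3 * a\<^sup>2 * b + 3 * (var_x - 1) * (a * b\<^sup>2)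
    + (var_x - 1)\<^sup>2 * b ^ 3"
proof -
  let ?e = "Upair HubA HubB" and ?p = "var_x - 1" and ?q = "var_y - 1" and ?V = "{HubB, HubA}"
  have n: "ncomp ?V {} = 2" "ncomp ?V {?e} = 1"
    using ncomp_pendant[of "{}" "{HubA}" HubB HubA]
    by (simp_all add: ncomp_empty edges_in_def)
  \<comment> \<open>Deleting the only edge leaves two components and contributes a factor
    \<open>?p\<close>; keeping it leaves one.\<close>
  have edge: "weighted_sum ?p ?q {} ?V {?e} \<alpha> \<beta> = \<beta> ?e * ?p + \<alpha> ?e" for \<alpha> \<beta>
    unfolding weighted_sum_def
    by (subst weighted_Pow_insert) (simp_all add: n weight_def joined_def)
  have "web_edges 0 = insert (Upair HubA HubC) (insert (Upair HubB HubC) {?e})"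
    "web_verts 0 = insert HubC ?V"
    by auto
  then have "web_sum {} 0 a b = weighted_sum ?p ?q {} (insert HubC ?V)
      (insert (Upair HubA HubC) (insert (Upair HubB HubC) {?e})) (\<lambda>_. a) (\<lambda>_. b)"
    by metis
  also have "\<dots> = (2 * a * b\<^sup>2 + ?p * b ^ 3) * ?p + (?q * a ^ 3 + 3 * a\<^sup>2 * b + ?p * a * b\<^sup>2)"
    using weighted_sum_eliminate_vertex[of ?V "{?e}" HubA HubB HubC "{}" "\<lambda>_. a" a "\<lambda>_. b" b ?p ?q]
    by (simp add: edges_in_def edge)
  finally show ?thesis by (simp add: algebra_simps power2_eq_square)
qed

lemma joined_path:
  assumes "Upair u v \<in> F" "Upair v w \<in> F"
  shows "joined {u, v, w} F"
proof -
  have uv: "(u, v) \<in> (adj F)\<^sup>*" and vw: "(v, w) \<in> (adj F)\<^sup>*"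
    using assms by (auto simp: adj_def)
  show ?thesis
    using uv vw rtrancl_trans[OF uv vw] uv[THEN adj_rtrancl_sym] vw[THEN adj_rtrancl_sym]
      rtrancl_trans[OF uv vw, THEN adj_rtrancl_sym]
    unfolding joined_def by simp
qed

lemma joined_imp_edge:
  assumes "joined S F" "s \<in> S" "t \<in> S" "s \<noteq> t"
  obtains z where "Upair s z \<in> F"
proof -
  have "(s, t) \<in> (adj F)\<^sup>*" using assms by (auto simp: joined_def)
  then show ?thesis
    using assms(4) that by (cases rule: converse_rtranclE) (auto simp: adj_def)
qed

text \<open>Every vertex belongs to the joined set, so none can be eliminated and the eight edge
  sets are enumerated. Fewer than two edges isolate a hub and weigh 0, two edges form a spanning
  path of weight 1, and all three have nullity one.\<close>

lemma T1_sum_triangle: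
  "web_sum {HubA, HubB, HubC} 0 a b = (var_y - 1) * a ^ 3 + 3 * a\<^sup>2 * b"
proof -
  let ?S = "{HubA, HubB, HubC}"
  let ?e = "Upair HubA HubB" and ?f = "Upair HubB HubC" and ?g = "Upair HubC HubA"
  let ?W = "weight (var_x - 1) (var_y - 1) ?S ?S"
  have W: "?W F = (var_y - 1) ^ (card F - 2)" if "joined ?S F" for F
    using that by (simp add: weight_def ncomp_joined numeral_2_eq_2)
  have W0: "?W F = 0" if "s \<in> ?S" "\<And>z. Upair s z \<notin> F" for s F
  proof -
    have "HubA \<noteq> HubB" by simp
    then obtain t where "t \<in> ?S" "s \<noteq> t" by blast
    then have "\<not> joined ?S F" using that joined_imp_edge[of ?S F s t] by blast
    then show ?thesis by (simp add: weight_def)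
  qed
  have zero: "?W {} = 0" "?W {?e} = 0" "?W {?f} = 0" "?W {?g} = 0"
    by (rule W0[of HubA], simp, simp, rule W0[of HubC], simp, simp,
        rule W0[of HubA], simp, simp, rule W0[of HubB], simp, simp)
  \<comment> \<open>\<open>joined_path\<close> lists the hubs in the order of the path; these
    equations identify the cyclic orders.\<close>
  have perm: "{HubC, HubA, HubB} = ?S" "{HubB, HubC, HubA} = ?S" by auto
  have "joined ?S F" if "{?e, ?f} \<subseteq> F \<or> {?e, ?g} \<subseteq> F \<or> {?f, ?g} \<subseteq> F" for F
    using that joined_path[of HubA HubB F HubC] joined_path[of HubC HubA F HubB]
      joined_path[of HubB HubC F HubA]
    unfolding perm by blast
  then have W2: "?W {?e, ?f} = 1" "?W {?e, ?g} = 1" "?W {?f, ?g} = 1"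
    "?W {?e, ?f, ?g} = var_y - 1"
    by (simp_all add: W)
  have "web_sum ?S 0 a b = (\<Sum>F\<in>Pow {?e, ?f, ?g}. ?W F * (\<Prod>e\<in>{?e, ?f, ?g}. if e \<in> F then a else b))"
    by (simp add: weighted_sum_def)
  also have "\<dots> = b * (b * (b * ?W {} + a * ?W {?e}) + a * (b * ?W {?f} + a * ?W {?e, ?f}))
      + a * (b * (b * ?W {?g} + a * ?W {?e, ?g}) + a * (b * ?W {?f, ?g} + a * ?W {?e, ?f, ?g}))"
    by (subst weighted_Pow_insert, simp, simp)+ (simp add: algebra_simps)
  also have "\<dots> = (var_y - 1) * a ^ 3 + 3 * a\<^sup>2 * b"
    unfolding zero W2 by (simp add: algebra_simps power2_eq_square power3_eq_cube)
  finally show ?thesis .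
qed

section \<open>The recurrences\<close>

text \<open>To be read with \<open>s = x - 1\<close>, \<open>u = y - 1\<close> and \<open>t\<close>,
  \<open>p\<close>, \<open>q\<close> the values of \<open>T1\<close>, \<open>P\<close>,
  \<open>Q\<close>: then \<open>t + s * p\<close> and \<open>2 * p + s * q\<close> are the next edge
  weights, and the left-hand sides are the next \<open>T1\<close>, \<open>P\<close> and
  \<open>Q\<close>.\<close>

lemma hub_polynomial_expand:
  fixes s u p q t :: "'a::idom"
  shows "u * (t + s * p) ^ 3 + 3 * (t + s * p) ^ 2 * (2 * p + s * q) =
      u * t ^ 3 + 3 * u * s * t ^ 2 * p + 3 * s^2 * u * t * p ^ 2 + s^3 * u * p ^ 3
      + 3 * s * t ^ 2 * q + 6 * t ^ 2 * p + 12 * s * t * p ^ 2 + 6 * s^2 * p ^ 3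
      + 3 * s^3 * p ^ 2 * q + 6 * s^2 * t * p * q"
    and "(t + s * p) * (2 * p + s * q) ^ 2 =
      4 * t * p ^ 2 + 4 * s * t * p * q + 4 * s * p ^ 3 + 4 * s^2 * p ^ 2 * q
      + s^2 * t * q ^ 2 + s^3 * p * q ^ 2"
    and "(2 * p + s * q) ^ 3 =
      8 * p ^ 3 + 12 * s * p ^ 2 * q + 6 * s^2 * p * q ^ 2 + s^3 * q ^ 3"
  by algebra+

theorem theorem3:
  fixes x y :: "int poly poly" and T :: "nat \<Rightarrow> int poly poly"
  defines "x \<equiv> var_x" and "y \<equiv> var_y" and "T \<equiv> (\<lambda>n. tutte (pseudofractal n))"
  shows "\<exists>P Q :: nat \<Rightarrow> int poly poly.
    (\<forall>n. T n = T1 n + 3 * (x - 1) * P n + (x - 1)^2 * Q n) \<and>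
    (\<forall>n. T1 (Suc n) =
        (y - 1) * T1 n ^ 3
      + 3 * (y - 1) * (x - 1) * T1 n ^ 2 * P n
      + 3 * (x - 1)^2 * (y - 1) * T1 n * P n ^ 2
      + (x - 1)^3 * (y - 1) * P n ^ 3
      + 3 * (x - 1) * T1 n ^ 2 * Q n
      + 6 * T1 n ^ 2 * P n
      + 12 * (x - 1) * T1 n * P n ^ 2
      + 6 * (x - 1)^2 * P n ^ 3
      + 3 * (x - 1)^3 * P n ^ 2 * Q n
      + 6 * (x - 1)^2 * T1 n * P n * Q n) \<and>
    (\<forall>n. P (Suc n) =
        4 * T1 n * P n ^ 2
      + 4 * (x - 1) * T1 n * P n * Q n
      + 4 * (x - 1) * P n ^ 3
      + 4 * (x - 1)^2 * P n ^ 2 * Q n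
      + (x - 1)^2 * T1 n * Q n ^ 2
      + (x - 1)^3 * P n * Q n ^ 2) \<and>
    (\<forall>n. Q (Suc n) =
        8 * P n ^ 3
      + 12 * (x - 1) * P n ^ 2 * Q n
      + 6 * (x - 1)^2 * P n * Q n ^ 2
      + (x - 1)^3 * Q n ^ 3) \<and>
    T1 0 = y + 2 \<and> P 0 = 1 \<and> Q 0 = 1"
proof -
  define a where "a n = fst ((edge_step ^^ n) (1, 1))" for n
  define b where "b n = snd ((edge_step ^^ n) (1, 1))" for n
  \<comment> \<open>The weight product of the triangle with one prescribed edge kept; the three
    choices of that edge and the one extra component give the coefficient
    \<open>3 * (x - 1)\<close>.\<close>
  define P where "P n = a n * b n ^ 2" for n
  define Q where "Q n = b n ^ 3" for n
  have ab0: "a 0 = 1" "b 0 = 1" by (simp_all add: a_def b_def)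
  have T1: "T1 n = (y - 1) * a n ^ 3 + 3 * a n ^ 2 * b n" for n
    unfolding T1_web web_sum_iterate[OF subset_refl, of n] T1_sum_triangle a_def b_def y_def ..
  have T: "T n = T1 n + 3 * (x - 1) * P n + (x - 1)^2 * Q n" for n
    unfolding T_def tutte_web web_sum_iterate[OF empty_subsetI, of n] tutte_sum_triangle
      T1 P_def Q_def a_def b_def x_def y_def ..
  have step: "(a (Suc n), b (Suc n)) = edge_step (a n, b n)" for n
    by (simp add: a_def b_def)
  have a: "a (Suc n) = T1 n + (x - 1) * P n"
    and b: "b (Suc n) = 2 * P n + (x - 1) * Q n" for n
    \<comment> \<open>Reassociating the products in \<open>edge_step\<close> exposes
      \<open>P n\<close> and \<open>Q n\<close> as factors.\<close>
    using step[of n] unfolding T1 P_def Q_def x_def y_def edge_step_def case_prod_conv Pair_inject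
      mult.assoc by blast+
  have "T1 (Suc n) =
        (y - 1) * T1 n ^ 3
      + 3 * (y - 1) * (x - 1) * T1 n ^ 2 * P n
      + 3 * (x - 1)^2 * (y - 1) * T1 n * P n ^ 2
      + (x - 1)^3 * (y - 1) * P n ^ 3
      + 3 * (x - 1) * T1 n ^ 2 * Q n
      + 6 * T1 n ^ 2 * P n
      + 12 * (x - 1) * T1 n * P n ^ 2
      + 6 * (x - 1)^2 * P n ^ 3
      + 3 * (x - 1)^3 * P n ^ 2 * Q n
      + 6 * (x - 1)^2 * T1 n * P n * Q n" for n
    unfolding T1[of "Suc n"] a b by (rule hub_polynomial_expand)
  moreover have "P (Suc n) =
        4 * T1 n * P n ^ 2
      + 4 * (x - 1) * T1 n * P n * Q n
      + 4 * (x - 1) * P n ^ 3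
      + 4 * (x - 1)^2 * P n ^ 2 * Q n
      + (x - 1)^2 * T1 n * Q n ^ 2
      + (x - 1)^3 * P n * Q n ^ 2" for n
    unfolding P_def[of "Suc n"] a b by (rule hub_polynomial_expand)
  moreover have "Q (Suc n) =
        8 * P n ^ 3
      + 12 * (x - 1) * P n ^ 2 * Q n
      + 6 * (x - 1)^2 * P n * Q n ^ 2
      + (x - 1)^3 * Q n ^ 3" for n
    unfolding Q_def[of "Suc n"] b by (rule hub_polynomial_expand)
  moreover have "T1 0 = y + 2" "P 0 = 1" "Q 0 = 1"
    by (simp_all add: T1 P_def Q_def ab0)
  ultimately show ?thesis using T by (intro exI[of _ P] exI[of _ Q] conjI allI)
qed

end
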